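(* Let $N \ge 1$ be the number of requests in a batch and $C \ge 1$ the capacity. For each request $i \in \{1,\dots,N\}$ and each draft position $j \ge 1$, let $\alpha_{i,j} \in [0,1]$ be the true acceptance rate of draft token $(i,j)$, i.e. the conditional probability that token $(i,j)$ is accepted given that tokens $(i,1),\dots,(i,j-1)$ are accepted. Assume drafting takes no time, so that the step time $\tau_{\text{step}}>0$ does not depend on which feasible set of draft tokens is selected. Then the set $\mathcal{D}^*$ returned by the TETRIS algorithm run with $p_{i,j} = \alpha_{i,j}$ maximizes the per-step throughput among all feasible selections: for every feasible selection $\mathcal{D}$, $$\mathcal{G}_{\text{step}}(\mathcal{D}) \le \mathcal{G}_{\text{step}}(\mathcal{D}^* ).$$
   Context: Setting (one step of batch speculative decoding). A server processes $N$ requests. For each request $i$ a draft model has produced a sequence of draft tokens indexed $(i,1),(i,2),\dots$ (positions counted from the last verified token; enough draft tokens are available that the algorithm below never runs out). The server can verify exactly $C$ draft tokens in the step. Feasible selection: a set $\mathcal{D}=\{(i,t): 1\le i\le N,\ 1\le t\le k_i\}$ with integers $k_i\ge 0$ and $\sum_{i=1}^N k_i = |\mathcal{D}| = C$ (tokens in a row cannot be skipped). Acceptance: $\mathbf{1}_{i,t}$ is the indicator that draft token $(i,t)$ is accepted. A token can be accepted only if all earlier tokens of the same request are accepted, so $\mathbb{E}[\mathbf{1}_{i,t}] = \prod_{s=1}^{t}\alpha_{i,s}$. Per-step throughput: $$\mathcal{G}_{\text{step}}(\mathcal{D}) = \frac{\mathbb{E}\big[\sum_{(i,t)\in\mathcal{D}}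 \mathbf{1}_{i,t}\big] + N}{\tau_{\text{step}}},$$ where the term $N$ accounts for one bonus token per request. TETRIS algorithm (inputs: numbers $p_{i,j}\in[0,1]$, batch size $N$, capacity $C$). Let $\mathcal{B}_{i,j} = (i,j,\prod_{t=1}^{j}p_{i,t})$. Start with $\mathcal{D}^*=\emptyset$ and a max-heap, keyed by the third component, containing $\mathcal{B}_{i,1}$ for every $i\in\{1,\dots,N\}$. Repeat until $|\mathcal{D}^*| = C$: extract from the heap an entry $(i,j,\cdot)$ with the largest key (ties broken arbitrarily), add $(i,j)$ to $\mathcal{D}^*$, and insert $\mathcal{B}_{i,j+1}$ into the heap. Return $\mathcal{D}^*$. *)

theory Defs
  imports "HOL-Probability.Probability" "HOL-Library.Multiset"
begin

text \<open>The draft token at position \<open>t\<close> of request \<open>i\<close> is the pair \<open>(i, t)\<close>; both indices count from 1.\<close>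

definition feasible_selection :: "nat \<Rightarrow> nat \<Rightarrow> (nat \<times> nat) set \<Rightarrow> bool" where
  "feasible_selection N C D \<longleftrightarrow>
     (\<exists>k :: nat \<Rightarrow> nat. D = {(i, t). 1 \<le> i \<and> i \<le> N \<and> 1 \<le> t \<and> t \<le> k i}
        \<and> (\<Sum>i = 1..N. k i) = card D \<and> card D = C)"

text \<open>\<open>A i t\<close> is the event that draft token \<open>(i, t)\<close> is accepted, and \<open>\<tau> D\<close> is the duration of
  the step when the set \<open>D\<close> is verified.\<close>

definition step_throughput ::
  "'a measure \<Rightarrow> (nat \<Rightarrow> nat \<Rightarrow> 'a set) \<Rightarrow> nat \<Rightarrow> ((nat \<times> nat) set \<Rightarrow> real) \<Rightarrow> (nat \<times> nat) set \<Rightarrow> real"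
where
  "step_throughput M A N \<tau> D =
     ((\<integral>\<omega>. (\<Sum>(i, t)\<in>D. indicator (A i t) \<omega>) \<partial>M) + real N) / \<tau> D"

type_synonym entry = "nat \<times> nat \<times> real"

definition tetris_entry :: "(nat \<Rightarrow> nat \<Rightarrow> real) \<Rightarrow> nat \<Rightarrow> nat \<Rightarrow> entry" where
  "tetris_entry p i j = (i, j, \<Prod>t = 1..j. p i t)"

text \<open>The max-heap is modelled abstractly by the multiset of its entries. Arbitrary tie-breaking
  is nondeterminism: \<open>tetris_state p N C D H\<close> holds iff some run of the loop reaches the
  selection \<open>D\<close> together with the heap \<open>H\<close>.\<close>

inductive tetris_state ::
  "(nat \<Rightarrow> nat \<Rightarrow> real) \<Rightarrow> nat \<Rightarrow> nat \<Rightarrow> (nat \<times> nat) set \<Rightarrow> entry multiset \<Rightarrow> bool"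
  for p :: "nat \<Rightarrow> nat \<Rightarrow> real" and N C :: nat
where
  init: "tetris_state p N C {} (image_mset (\<lambda>i. tetris_entry p i 1) (mset_set {1..N}))"
| extract_max: "\<lbrakk>tetris_state p N C D H; card D \<noteq> C; (i, j, v) \<in># H;
     \<And>i' j' v'. (i', j', v') \<in># H \<Longrightarrow> v' \<le> v\<rbrakk>
   \<Longrightarrow> tetris_state p N C (insert (i, j) D) (add_mset (tetris_entry p i (j + 1)) (H - {#(i, j, v)#}))"

definition tetris_returns ::
  "(nat \<Rightarrow> nat \<Rightarrow> real) \<Rightarrow> nat \<Rightarrow> nat \<Rightarrow> (nat \<times> nat) set \<Rightarrow> bool" where
  "tetris_returns p N C D \<longleftrightarrow> (\<exists>H. tetris_state p N C D H) \<and> card D = C"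

text \<open>The algorithm has at least one possible output.\<close>

lemma tetris_returns_exists:
  assumes "N \<ge> 1"
  shows "\<exists>D. tetris_returns p N C D"
proof -
  have "n \<le> C \<Longrightarrow> \<exists>D k. card D = n \<and> finite D \<and> (\<forall>i t. (i, t) \<in> D \<longrightarrow> t \<le> k i) \<and>
      tetris_state p N C D (image_mset (\<lambda>i. tetris_entry p i (Suc (k i))) (mset_set {1..N}))" for n
  proof (induction n)
    case 0
    show ?case
      by (rule exI[of _ "{}"], rule exI[of _ "\<lambda>_. 0"]) (use tetris_state.init in auto)
  next
    case (Suc n)
    then obtain D k where D: "card D = n" "finite D" "\<And>i t. (i, t) \<in> D \<Longrightarrow> t \<le> k i"
      and st: "tetris_state p N C D (image_mset (\<lambda>i. tetris_entry p i (Suc (k i))) (mset_set {1..N}))"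
        (is "tetris_state p N C D ?H")
      by auto
    define f where "f i = (\<Prod>t = 1..Suc (k i). p i t)" for i
    have entry: "tetris_entry p i (Suc (k i)) = (i, Suc (k i), f i)" for i
      by (simp add: tetris_entry_def f_def)
    have fin: "finite (f ` {1..N})" "f ` {1..N} \<noteq> {}"
      using assms by auto
    obtain m where m: "m \<in> {1..N}" "f m = Max (f ` {1..N})"
      using Max_in[OF fin] by auto
    have max: "f i \<le> f m" if "i \<in> {1..N}" for i
      using that m fin by auto
    have rem: "mset_set {1..N} = add_mset m (mset_set ({1..N} - {m}))"
      using m(1) by (simp only: mset_set.remove finite_atLeastAtMost)
    have "tetris_state p N C (insert (m, Suc (k m)) D)
      (add_mset (tetris_entry p m (Suc (k m) + 1)) (?H - {#(m, Suc (k m), f m)#}))"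
      using st D(1) Suc.prems m(1) max by (intro tetris_state.extract_max) (auto simp: entry)
    also have "?H - {#(m, Suc (k m), f m)#} =
        image_mset (\<lambda>i. tetris_entry p i (Suc (k i))) (mset_set ({1..N} - {m}))"
      unfolding rem by (simp add: entry)
    also have "add_mset (tetris_entry p m (Suc (k m) + 1)) \<dots> =
        image_mset (\<lambda>i. tetris_entry p i (Suc ((k(m := Suc (k m))) i))) (mset_set {1..N})"
    proof -
      have "image_mset (\<lambda>i. tetris_entry p i (Suc (k i))) (mset_set ({1..N} - {m})) =
        image_mset (\<lambda>i. tetris_entry p i (Suc ((k(m := Suc (k m))) i))) (mset_set ({1..N} - {m}))"
        by (intro image_mset_cong) auto
      then show ?thesis
        unfolding rem by simp
    qed
    finally have new: "tetris_state p N C (insert (m, Suc (k m)) D) \<dots>" .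
    have "(m, Suc (k m)) \<notin> D"
      using D(3) by force
    then show ?case
      using D new
      by (intro exI[of _ "insert (m, Suc (k m)) D"] exI[of _ "k(m := Suc (k m))"])
         (auto intro: le_SucI)
  qed
  from this[of C] show ?thesis
    by (auto simp: tetris_returns_def)
qed

end

theory Submission
  imports Defs
begin

text \<open>The expected number of accepted tokens of a selection is the sum of the scores
  \<open>q i t = \<alpha> i 1 * \<dots> * \<alpha> i t\<close> of its elements. Scores decrease along each request, so
  every token outside the TETRIS selection scores at most the heap entry of its request, which
  in turn scores at most every selected token. Hence the selection consists of \<open>C\<close> tokens of
  maximal score.\<close>

text \<open>As a dependent product over rows, a selection is visibly finite and its cardinality is a
  sum of row lengths. \<open>k i\<close> is the number of tokens taken from request
  \<open>i\<close>.\<close>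

definition prefix_set :: "nat \<Rightarrow> (nat \<Rightarrow> nat) \<Rightarrow> (nat \<times> nat) set" where
  "prefix_set N k = (SIGMA i:{1..N}. {1..k i})"

lemma finite_prefix_set [simp]: "finite (prefix_set N k)"
  by (simp add: prefix_set_def)

lemma card_prefix_set: "card (prefix_set N k) = (\<Sum>i = 1..N. k i)"
  by (simp add: prefix_set_def)

lemma mem_prefix_set [simp]:
  "(i, t) \<in> prefix_set N k \<longleftrightarrow> i \<in> {1..N} \<and> 1 \<le> t \<and> t \<le> k i"
  by (auto simp: prefix_set_def)

text \<open>The equation between the sum of row lengths and \<open>card D\<close> holds for every
  prefix set, so only \<open>card D = C\<close> remains as a constraint.\<close>

lemma feasible_selection_iff:
  "feasible_selection N C D \<longleftrightarrow> (\<exists>k. D = prefix_set N k \<and> card D = C)"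
proof -
  have "{(i, t). 1 \<le> i \<and> i \<le> N \<and> 1 \<le> t \<and> t \<le> k i} = prefix_set N k" for k
    by auto
  then show ?thesis
    unfolding feasible_selection_def by (metis card_prefix_set)
qed

lemma insert_prefix_set:
  assumes "m \<in> {1..N}"
  shows "insert (m, Suc (k m)) (prefix_set N k) = prefix_set N (k(m := Suc (k m)))"
  using assms by (auto split: if_splits)

text \<open>The common part of \<open>S\<close> and \<open>T\<close> contributes equally to both
  sums. The two differences have equal size, and since \<open>le\<close> compares all pairs, any
  bijection between them gives the bound.\<close>

lemma sum_le_sum_of_exchange:
  fixes f :: "'b \<Rightarrow> real"
  assumes "finite S" "finite T" "card S = card T"
    and le: "\<And>x y. x \<in> S - T \<Longrightarrow> y \<in> T - S \<Longrightarrow> f x \<le> f y"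
  shows "sum f S \<le> sum f T"
proof -
  have "card (S - T) = card (T - S)"
    using assms by (metis card_Diff_subset_Int finite_Int inf_commute)
  then obtain h where h: "bij_betw h (S - T) (T - S)"
    using finite_same_card_bij[of "S - T" "T - S"] assms(1,2) by auto
  have "sum f (S - T) \<le> (\<Sum>x\<in>S - T. f (h x))"
    using h by (intro sum_mono le) (auto simp: bij_betw_def)
  also have "\<dots> = sum f (T - S)"
    using h by (rule sum.reindex_bij_betw)
  finally show ?thesis
    using sum.Int_Diff[of S f T] sum.Int_Diff[of T f S] assms by (simp add: inf_commute)
qed

lemma prod_prefix_antimono:
  fixes p :: "nat \<Rightarrow> real"
  assumes "\<And>j. 1 \<le> j \<Longrightarrow> p j \<in> {0..1}" and "s \<le> t"
  shows "(\<Prod>j = 1..t. p j) \<le> (\<Prod>j = 1..s. p j)"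
  using assms(2)
proof (induction t rule: dec_induct)
  case (step n)
  have "(\<Prod>j = 1..n. p j) * p (Suc n) \<le> (\<Prod>j = 1..n. p j)"
    using assms(1) by (intro mult_right_le_one_le prod_nonneg) auto
  then show ?case
    using step.IH by simp
qed simp

text \<open>The heap always holds exactly one entry per request, its first unselected token
  \<open>Suc (k i)\<close>. An extracted token is a maximum of the heap, and its replacement has a
  key no larger because the factors lie in [0,1]; so the heap keys never rise above the score of a
  selected token.\<close>

lemma tetris_state_invariant:
  fixes p :: "nat \<Rightarrow> nat \<Rightarrow> real"
  defines "q \<equiv> \<lambda>i t. \<Prod>s = 1..t. p i s"
  assumes p: "\<And>i j. i \<in> {1..N} \<Longrightarrow> 1 \<le> j \<Longrightarrow> p i j \<in> {0..1}"
    and "tetris_state p N C D H"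
  shows "\<exists>k. D = prefix_set N k \<and>
      H = image_mset (\<lambda>i. tetris_entry p i (Suc (k i))) (mset_set {1..N}) \<and>
      (\<forall>(i, t)\<in>D. \<forall>i'\<in>{1..N}. q i' (Suc (k i')) \<le> q i t)"
  using assms(3)
proof induction
  case init
  show ?case
    by (rule exI[of _ "\<lambda>_. 0"]) (auto simp: prefix_set_def)
next
  case (extract_max D H m j v)
  then obtain k where D: "D = prefix_set N k"
    and H: "H = image_mset (\<lambda>i. tetris_entry p i (Suc (k i))) (mset_set {1..N})"
    and le: "\<And>i t i'. (i, t) \<in> D \<Longrightarrow> i' \<in> {1..N} \<Longrightarrow> q i' (Suc (k i')) \<le> q i t"
    by fast
  have entry: "tetris_entry p i t = (i, t, q i t)" for i t
    by (simp add: tetris_entry_def q_def)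
  have m: "m \<in> {1..N}" and j: "j = Suc (k m)" and v: "v = q m (Suc (k m))"
    using extract_max.hyps(3) unfolding H entry by auto
  have max: "q i (Suc (k i)) \<le> q m (Suc (k m))" if "i \<in> {1..N}" for i
    using extract_max.hyps(4)[of i "Suc (k i)" "q i (Suc (k i))"] that
    unfolding H entry v by auto
  define k' where "k' = k(m := Suc (k m))"
  \<comment> \<open>Only row \<open>m\<close> advances, so heap keys can only drop. Bounds by the
    old keys, for earlier selections through \<open>le\<close> and for the new token through
    \<open>max\<close>, therefore carry over to the new heap.\<close>
  have mono: "q i (Suc (k' i)) \<le> q i (Suc (k i))" if "i \<in> {1..N}" for i
    unfolding q_def k'_def using p that by (intro prod_prefix_antimono) auto
  have "insert (m, j) D = prefix_set N k'"
    unfolding D j k'_def using m by (rule insert_prefix_set)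
  moreover have "add_mset (tetris_entry p m (j + 1)) (H - {#(m, j, v)#}) =
      image_mset (\<lambda>i. tetris_entry p i (Suc (k' i))) (mset_set {1..N})"
  proof -
    \<comment> \<open>Splitting off \<open>m\<close> isolates the one heap entry that is exchanged;
      the others do not see the update of \<open>k\<close>.\<close>
    have rem: "mset_set {1..N} = add_mset m (mset_set ({1..N} - {m}))"
      using m by (simp only: mset_set.remove finite_atLeastAtMost)
    have "image_mset (\<lambda>i. tetris_entry p i (Suc (k i))) (mset_set ({1..N} - {m})) =
        image_mset (\<lambda>i. tetris_entry p i (Suc (k' i))) (mset_set ({1..N} - {m}))"
      by (intro image_mset_cong) (auto simp: k'_def)
    then show ?thesis
      unfolding H rem by (simp add: entry j v k'_def)
  qed
  moreover have "q i' (Suc (k' i')) \<le> q i t"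
    if "(i, t) \<in> insert (m, j) D" "i' \<in> {1..N}" for i t i'
    using that mono[of i'] max[of i'] le[of i t i'] j by force
  ultimately show ?case
    by blast
qed

context prob_space
begin

text \<open>This is the chain rule for nested events. The rate \<open>a j\<close> is tied to a
  conditional probability only when the conditioning event has positive probability.\<close>

lemma prob_eq_prod_cond_prob:
  fixes B :: "nat \<Rightarrow> 'a set" and a :: "nat \<Rightarrow> real"
  assumes sets: "\<And>t. 1 \<le> t \<Longrightarrow> B t \<in> events"
    and dec: "\<And>s t. 1 \<le> s \<Longrightarrow> s \<le> t \<Longrightarrow> B t \<subseteq> B s"
    and a: "\<And>j. 1 \<le> j \<Longrightarrow> \<P>(\<omega> in M. \<forall>s\<in>{1..<j}. \<omega> \<in> B s) > 0 \<Longrightarrow>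
      a j = \<P>(\<omega> in M. \<omega> \<in> B j \<bar> \<forall>s\<in>{1..<j}. \<omega> \<in> B s)"
    and "1 \<le> t"
  shows "prob (B t) = (\<Prod>s = 1..t. a s)"
proof -
  \<comment> \<open>\<open>E j\<close> is the event that the first \<open>j\<close> tokens are all
    accepted. It has the shape of the conditioning event for token \<open>Suc j\<close>, and
    \<open>E 0\<close> is the whole space, matching the empty product.\<close>
  define E where "E j = {\<omega> \<in> space M. \<forall>s\<in>{1..<Suc j}. \<omega> \<in> B s}" for j
  have E: "E j = B j" if "1 \<le> j" for j
    using that dec[of _ j] sets[of j, THEN sets.sets_into_space] unfolding E_def by force
  have "prob (E t) = (\<Prod>s = 1..t. a s)" for t
  proof (induction t)
    case 0
    show ?case
      by (simp add: E_def prob_space)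
  next
    case (Suc t)
    have sub: "E (Suc t) \<subseteq> E t"
      by (auto simp: E_def)
    have "E t \<in> events"
      using E[of t] sets[of t] by (cases "t = 0") (auto simp: E_def)
    then have le: "prob (E (Suc t)) \<le> prob (E t)"
      using sub by (intro finite_measure_mono)
    have "prob (E (Suc t)) = prob (E t) * a (Suc t)"
    proof (cases "prob (E t) = 0")
      \<comment> \<open>Here \<open>a (Suc t)\<close> is unconstrained, but \<open>E (Suc t)\<close>
        lies in the null event \<open>E t\<close>, so both sides vanish.\<close>
      case True
      then show ?thesis
        using le by (simp add: measure_le_0_iff)
    next
      case False
      then have "prob (E t) > 0"
        by (simp add: zero_less_measure_iff)
      then have "a (Suc t) = \<P>(\<omega> in M. \<omega> \<in> B (Suc t) \<bar> \<forall>s\<in>{1..<Suc t}. \<omega> \<in> B s)"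
        using a[of "Suc t"] by (simp add: E_def)
      also have "\<dots> = prob (E (Suc t)) / prob (E t)"
      proof -
        have "{\<omega> \<in> space M. \<omega> \<in> B (Suc t) \<and> (\<forall>s\<in>{1..<Suc t}. \<omega> \<in> B s)} = E (Suc t)"
          by (auto simp: E_def less_Suc_eq)
        then show ?thesis
          by (simp add: cond_prob_def E_def)
      qed
      finally show ?thesis
        using False by simp
    qed
    then show ?case
      using Suc.IH by simp
  qed
  from this[of t] show ?thesis
    using E[OF \<open>1 \<le> t\<close>] by simp
qed

text \<open>Linearity of expectation turns expected acceptances into a sum of probabilities,
  although the acceptances within a request are dependent.\<close>

lemma integral_sum_indicator:
  assumes "\<And>i t. (i, t) \<in> D \<Longrightarrow> A i t \<in> events"
  shows "(\<integral>\<omega>. (\<Sum>(i, t)\<in>D. indicator (A i t) \<omega>) \<partial>M) = (\<Sum>(i, t)\<in>D. prob (A i t))"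
proof -
  have "(\<integral>\<omega>. (\<Sum>x\<in>D. indicator (A (fst x) (snd x)) \<omega> :: real) \<partial>M) =
      (\<Sum>x\<in>D. \<integral>\<omega>. indicator (A (fst x) (snd x)) \<omega> \<partial>M)"
    using assms by (intro Bochner_Integration.integral_sum) (auto simp: emeasure_eq_measure)
  also have "\<dots> = (\<Sum>x\<in>D. prob (A (fst x) (snd x)))"
    using assms by (intro sum.cong) (auto simp: Int_absorb2 sets.sets_into_space)
  finally show ?thesis
    by (simp add: case_prod_unfold)
qed

end

theorem theorem1:
  fixes M :: "'a measure"
    and A :: "nat \<Rightarrow> nat \<Rightarrow> 'a set"
    and \<alpha> :: "nat \<Rightarrow> nat \<Rightarrow> real"
    and \<tau> :: "(nat \<times> nat) set \<Rightarrow> real"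
    and \<tau>_step :: real
    and N C :: nat
    and D_star :: "(nat \<times> nat) set"
  assumes "prob_space M"
    and "N \<ge> 1" and "C \<ge> 1"
    and "\<And>i t. \<lbrakk>i \<in> {1..N}; t \<ge> 1\<rbrakk> \<Longrightarrow> A i t \<in> sets M"
    and "\<And>i s t. \<lbrakk>i \<in> {1..N}; 1 \<le> s; s \<le> t\<rbrakk> \<Longrightarrow> A i t \<subseteq> A i s"
    and "\<And>i j. \<lbrakk>i \<in> {1..N}; j \<ge> 1\<rbrakk> \<Longrightarrow> \<alpha> i j \<in> {0..1}"
    and "\<And>i j. \<lbrakk>i \<in> {1..N}; j \<ge> 1; \<P>(\<omega> in M. \<forall>s\<in>{1..<j}. \<omega> \<in> A i s) > 0\<rbrakk>
          \<Longrightarrow> \<alpha> i j = \<P>(\<omega> in M. \<omega> \<in> A i j \<bar> \<forall>s\<in>{1..<j}. \<omega> \<in> A i s)"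
    and "\<tau>_step > 0"
    and "\<And>D. feasible_selection N C D \<Longrightarrow> \<tau> D = \<tau>_step"
    and "tetris_returns \<alpha> N C D_star"
  shows "feasible_selection N C D_star \<and>
    (\<forall>D. feasible_selection N C D \<longrightarrow>
       step_throughput M A N \<tau> D \<le> step_throughput M A N \<tau> D_star)"
proof -
  interpret prob_space M
    by fact
  define q where "q i t = (\<Prod>s = 1..t. \<alpha> i s)" for i t
  have prob: "prob (A i t) = q i t" if "i \<in> {1..N}" "1 \<le> t" for i t
    unfolding q_def using assms(4,5,7) that by (intro prob_eq_prod_cond_prob) auto
  \<comment> \<open>On feasible sets the duration is the constant \<open>\<tau>_step\<close>, so
    throughput is an increasing affine function of the total score.\<close>
  have throughput: "step_throughput M A N \<tau> D = ((\<Sum>(i, t)\<in>D. q i t) + real N) / \<tau>_step"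
    if feasible: "feasible_selection N C D" for D
  proof -
    have D: "i \<in> {1..N} \<and> 1 \<le> t" if "(i, t) \<in> D" for i t
      using feasible that by (auto simp: feasible_selection_iff)
    have "(\<integral>\<omega>. (\<Sum>(i, t)\<in>D. indicator (A i t) \<omega>) \<partial>M) = (\<Sum>(i, t)\<in>D. prob (A i t))"
      using D assms(4) by (intro integral_sum_indicator) blast
    also have "\<dots> = (\<Sum>(i, t)\<in>D. q i t)"
      using D prob by (intro sum.cong) auto
    finally show ?thesis
      using assms(9)[OF feasible] by (simp add: step_throughput_def)
  qed
  obtain H where state: "tetris_state \<alpha> N C D_star H" and card_star: "card D_star = C"
    using assms(10) by (auto simp: tetris_returns_def)
  obtain k where star: "D_star = prefix_set N k"
    and le: "\<And>i t i'. (i, t) \<in> D_star \<Longrightarrow> i' \<in> {1..N} \<Longrightarrow> q i' (Suc (k i')) \<le> q i t"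
    using tetris_state_invariant[OF assms(6) state] unfolding q_def by fast
  have feasible_star: "feasible_selection N C D_star"
    using star card_star by (auto simp: feasible_selection_iff)
  have "step_throughput M A N \<tau> D \<le> step_throughput M A N \<tau> D_star"
    if feasible: "feasible_selection N C D" for D
  proof -
    obtain l where D: "D = prefix_set N l" and card: "card D = C"
      using feasible by (auto simp: feasible_selection_iff)
    have exchange: "q i t \<le> q i' t'" if "(i, t) \<in> D - D_star" "(i', t') \<in> D_star" for i t i' t'
    proof -
      \<comment> \<open>A token of row \<open>i\<close> missing from \<open>D_star\<close> lies
        beyond the prefix of length \<open>k i\<close>, hence at or after the position on the
        heap.\<close>
      have i: "i \<in> {1..N}" and t: "Suc (k i) \<le> t"
        using that(1) by (auto simp: D star)
      have "q i t \<le> q i (Suc (k i))"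
        unfolding q_def using assms(6) i t by (intro prod_prefix_antimono) auto
      also have "\<dots> \<le> q i' t'"
        using le that(2) i by blast
      finally show ?thesis .
    qed
    have "(\<Sum>(i, t)\<in>D. q i t) \<le> (\<Sum>(i, t)\<in>D_star. q i t)"
      using card card_star exchange
      by (intro sum_le_sum_of_exchange) (auto simp: D star split: prod.splits)
    then show ?thesis
      using \<open>\<tau>_step > 0\<close> feasible feasible_star by (simp add: throughput divide_right_mono)
  qed
  then show ?thesis
    using feasible_star by blast
qed

end
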